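(* Let $B(z),C(z)$ be analytic at $z=0$ with $B(0)=C(0)=1$, and let $B\circ C(z)=B(C(z)-1)$. Then for all $n\ge k\ge 0$, \[ s_{B\circ C}(n,k)=\sum_{j=k}^{n}S_C(n,j)s_B(j,k),\qquad S_{B\circ C}(n,k)=\sum_{j=k}^{n}S_C(n,j)S_B(j,k). \] As a consequence, $s_C(n,k)=\sum_{j=k}^{n}S_C(n,j)s(j,k)$.
   Context: For $F$ analytic at $0$ with $F(0)=1$, $\log F(z)$ is the branch with $\log F(0)=0$ near $0$, and the $F$-Stirling numbers are defined by $\frac{(\log F(z))^k}{k!}=\sum_{n\ge k}s_F(n,k)\frac{z^n}{n!}$ and $\frac{(F(z)-1)^k}{k!}=\sum_{n\ge k}S_F(n,k)\frac{z^n}{n!}$. The $s(n,k)$ are the (signed) Stirling numbers of the first kind: $\frac{(\log(1+z))^k}{k!}=\sum_{n\ge k}s(n,k)\frac{z^n}{n!}$. *)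

theory Defs
  imports "HOL-Complex_Analysis.Complex_Analysis" "HOL-Combinatorics.Stirling"
begin

text \<open>
  \<open>egf_coeff f n\<close> is the coefficient of \<open>z ^ n / n!\<close> in the Taylor expansion of \<open>f\<close> at 0.
\<close>

definition egf_coeff :: "(complex \<Rightarrow> complex) \<Rightarrow> nat \<Rightarrow> complex" where
  "egf_coeff f n = fact n * fps_nth (fps_expansion f 0) n"

text \<open>
  For \<open>F\<close> continuous at 0 with \<open>F 0 = 1\<close>, the principal branch \<open>Ln (F z)\<close> is, near 0, the branch of
  \<open>log F\<close> that vanishes at 0.
\<close>

definition F_stirling1 :: "(complex \<Rightarrow> complex) \<Rightarrow> nat \<Rightarrow> nat \<Rightarrow> complex" where
  "F_stirling1 F n k = egf_coeff (\<lambda>z. Ln (F z) ^ k / fact k) n"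

definition F_stirling2 :: "(complex \<Rightarrow> complex) \<Rightarrow> nat \<Rightarrow> nat \<Rightarrow> complex" where
  "F_stirling2 F n k = egf_coeff (\<lambda>z. (F z - 1) ^ k / fact k) n"

definition signed_stirling1 :: "nat \<Rightarrow> nat \<Rightarrow> complex" where
  "signed_stirling1 n k = egf_coeff (\<lambda>z. Ln (1 + z) ^ k / fact k) n"

definition shifted_comp :: "(complex \<Rightarrow> complex) \<Rightarrow> (complex \<Rightarrow> complex) \<Rightarrow> complex \<Rightarrow> complex" where
  "shifted_comp B C z = B (C z - 1)"

text \<open>
  The defining expansions: the coefficients vanish for \<open>n < k\<close>, and the series converges to the
  generating function near 0.
\<close>

lemma egf_coeff_sums:
  assumes "f analytic_on {0}"
  shows "eventually (\<lambda>z. (\<lambda>n. egf_coeff f n * z ^ n / fact n) sums f z) (nhds 0)"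
proof -
  let ?G = "fps_expansion f 0"
  have G: "f has_fps_expansion ?G"
    by (rule analytic_at_imp_has_fps_expansion_0[OF assms])
  then have "eventually (\<lambda>z. z \<in> eball 0 (fps_conv_radius ?G)) (nhds 0)"
    by (intro eventually_nhds_in_open) (auto simp: has_fps_expansion_def zero_ereal_def)
  moreover from G have "eventually (\<lambda>z. eval_fps ?G z = f z) (nhds 0)"
    by (auto simp: has_fps_expansion_def)
  ultimately show ?thesis
  proof eventually_elim
    case (elim z)
    then have "(\<lambda>n. fps_nth ?G n * z ^ n) sums f z"
      using sums_eval_fps[of z ?G] by (simp add: in_eball_iff)
    then show ?case
      by (simp add: egf_coeff_def)
  qed
qed

lemma egf_coeff_power_eq_0:
  assumes "f analytic_on {0}" "f 0 = 0" "n < k"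
  shows "egf_coeff (\<lambda>z. f z ^ k / fact k) n = 0"
proof -
  let ?G = "fps_expansion f 0"
  have G: "f has_fps_expansion ?G"
    by (rule analytic_at_imp_has_fps_expansion_0[OF assms(1)])
  have "(\<lambda>z. f z ^ k * (1 / fact k)) has_fps_expansion ?G ^ k * fps_const (1 / fact k)"
    by (intro fps_expansion_intros G)
  then have "(\<lambda>z. f z ^ k / fact k) has_fps_expansion ?G ^ k * fps_const (1 / fact k)"
    by simp
  from fps_nth_fps_expansion[OF this, of n]
  have "egf_coeff (\<lambda>z. f z ^ k / fact k) n
      = fact n * fps_nth (?G ^ k * fps_const (1 / fact k)) n"
    by (simp add: egf_coeff_def fps_expansion_def)
  moreover have "fps_nth ?G 0 = 0"
    using assms(2) by (simp add: fps_expansion_def)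
  then have "fps_nth (?G ^ k) n = 0"
    using assms(3) startsby_zero_power_prefix by blast
  ultimately show ?thesis
    by simp
qed

lemma Ln_analytic_at_0:
  assumes "F analytic_on {0}" "F 0 = 1"
  shows "(\<lambda>z. Ln (F z)) analytic_on {0}"
  using assms by (intro analytic_intros) auto

lemma F_stirling1_eq_0:
  assumes "F analytic_on {0}" "F 0 = 1" "n < k"
  shows "F_stirling1 F n k = 0"
  unfolding F_stirling1_def
  using assms Ln_analytic_at_0 by (intro egf_coeff_power_eq_0) auto

lemma F_stirling2_eq_0:
  assumes "F analytic_on {0}" "F 0 = 1" "n < k"
  shows "F_stirling2 F n k = 0"
  unfolding F_stirling2_def
  using assms by (intro egf_coeff_power_eq_0 analytic_intros) auto

lemma F_stirling1_sums:
  assumes "F analytic_on {0}" "F 0 = 1"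
  shows "eventually (\<lambda>z. (\<lambda>n. F_stirling1 F n k * z ^ n / fact n) sums (Ln (F z) ^ k / fact k))
           (nhds 0)"
  unfolding F_stirling1_def
  using assms by (intro egf_coeff_sums analytic_intros) auto

lemma F_stirling2_sums:
  assumes "F analytic_on {0}"
  shows "eventually (\<lambda>z. (\<lambda>n. F_stirling2 F n k * z ^ n / fact n) sums ((F z - 1) ^ k / fact k))
           (nhds 0)"
  unfolding F_stirling2_def
  using assms by (intro egf_coeff_sums analytic_intros) auto

lemma signed_stirling1_0: "signed_stirling1 n 0 = (if n = 0 then 1 else 0)"
proof -
  have "(\<lambda>z::complex. 1) has_fps_expansion 1"
    by simp
  from fps_nth_fps_expansion[OF this, of n] show ?thesis
    by (simp add: signed_stirling1_def egf_coeff_def fps_expansion_def split: if_splits)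
qed

lemma signed_stirling1_less:
  assumes "n < k"
  shows "signed_stirling1 n k = 0"
proof -
  have "(\<lambda>z::complex. 1 + z) analytic_on {0}"
    by (intro analytic_intros)
  from F_stirling1_eq_0[OF this _ assms] show ?thesis
    by (simp add: F_stirling1_def signed_stirling1_def)
qed

lemma signed_stirling1_Suc_Suc:
  "signed_stirling1 (Suc n) (Suc k) = signed_stirling1 n k - of_nat n * signed_stirling1 n (Suc k)"
proof -
  define f where "f = (\<lambda>k z. Ln (1 + z) ^ k / fact k)"
  define G where "G = (\<lambda>k. fps_expansion (f k) 0)"
  have an: "f k analytic_on {0}" for k
    unfolding f_def by (intro analytic_intros) auto
  have G: "f k has_fps_expansion G k" for k
    unfolding G_def by (rule analytic_at_imp_has_fps_expansion_0[OF an])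
  have D: "(\<lambda>z. (1 + z) * deriv (f (Suc k)) z) has_fps_expansion (1 + fps_X) * fps_deriv (G (Suc k))"
    by (intro fps_expansion_intros G)
  have ev: "eventually (\<lambda>z. (1 + z) * deriv (f (Suc k)) z = f k z) (nhds 0)"
  proof -
    have "eventually (\<lambda>z::complex. z \<in> ball 0 1) (nhds 0)"
      by (intro eventually_nhds_in_open) auto
    then show ?thesis
    proof eventually_elim
      case (elim z)
      then have "\<bar>Re z\<bar> < 1"
        using abs_Re_le_cmod[of z] by simp
      then have Re: "Re (1 + z) > 0"
        by simp
      then have nz: "1 + z \<noteq> 0" and np: "1 + z \<notin> \<real>\<^sub>\<le>\<^sub>0"
        by (auto simp: complex_nonpos_Reals_iff complex_eq_iff)
      have Ln': "((\<lambda>z. Ln (1 + z)) has_field_derivative 1 / (1 + z)) (at z)"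
        using np by (auto intro!: derivative_eq_intros simp: inverse_eq_divide)
      have "(f (Suc k) has_field_derivative
              of_nat (Suc k) * Ln (1 + z) ^ k * (1 / (1 + z)) / fact (Suc k)) (at z)"
        unfolding f_def
        using DERIV_cdivide[OF DERIV_power[OF Ln', of "Suc k"], of "fact (Suc k)"]
        by (simp del: fact_Suc of_nat_Suc power_Suc add: mult_ac)
      then have "deriv (f (Suc k)) z
          = of_nat (Suc k) * Ln (1 + z) ^ k * (1 / (1 + z)) / fact (Suc k)"
        by (rule DERIV_imp_deriv)
      also have "\<dots> = Ln (1 + z) ^ k / (1 + z) / fact k"
        using nz by (simp add: fact_Suc del: of_nat_Suc)
      finally show ?case
        using nz by (simp add: f_def)
    qed
  qed
  have "f k has_fps_expansion (1 + fps_X) * fps_deriv (G (Suc k))"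
    using D has_fps_expansion_cong[OF ev refl] by simp
  with G[of k] have eq: "G k = (1 + fps_X) * fps_deriv (G (Suc k))"
    by (metis fps_expansion_unique_complex)
  have "fps_nth (G k) n
      = of_nat (Suc n) * fps_nth (G (Suc k)) (Suc n) + of_nat n * fps_nth (G (Suc k)) n"
    unfolding eq by (cases n) (simp_all add: distrib_right)
  then have "fact n * fps_nth (G k) n
      = fact (Suc n) * fps_nth (G (Suc k)) (Suc n) + of_nat n * (fact n * fps_nth (G (Suc k)) n)"
    by (simp add: algebra_simps)
  then show ?thesis
    by (simp add: signed_stirling1_def egf_coeff_def G_def f_def del: fact_Suc)
qed

lemma signed_stirling1_eq_stirling:
  "signed_stirling1 n k = (-1) ^ (n + k) * of_nat (stirling n k)"
  by (induction n k rule: stirling.induct)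
     (simp_all add: signed_stirling1_0 signed_stirling1_less signed_stirling1_Suc_Suc algebra_simps)

end

theory Submission
  imports Defs
begin

text \<open>
  All three identities are instances of one fact: the coefficients of \<open>f \<circ> g\<close> with \<open>g 0 = 0\<close> are
  obtained by substituting the series of \<open>g\<close> into that of \<open>f\<close>, and the divided powers
  \<open>g ^ j / j!\<close> with \<open>g = C - 1\<close> have the numbers \<open>S_C(n, j)\<close> as coefficients. Take \<open>f\<close> to be
  \<open>(log B)^k / k!\<close>, \<open>(B - 1)^k / k!\<close> and \<open>(log (1 + z))^k / k!\<close>; the terms with \<open>j < k\<close> vanish.
\<close>

lemma egf_coeff_has_fps_expansion:
  assumes "f has_fps_expansion G"
  shows "egf_coeff f n = fact n * fps_nth G n"
  using fps_nth_fps_expansion[OF assms, of n] by (simp add: egf_coeff_def fps_expansion_def)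

text \<open>Since \<open>g\<close> vanishes at 0, formal composition applies: its n-th coefficient
  is the sum of \<open>F_j * (G ^ j)_n\<close> over j \<le> n, and the j! in
  \<open>egf_coeff f j\<close> cancels the one dividing \<open>g z ^ j\<close>.\<close>

lemma egf_coeff_compose:
  assumes f: "f analytic_on {0}" and g: "g analytic_on {0}" and g0: "g 0 = 0"
  shows "egf_coeff (\<lambda>z. f (g z)) n =
           (\<Sum>j=0..n. egf_coeff (\<lambda>z. g z ^ j / fact j) n * egf_coeff f j)"
proof -
  define F G where "F = fps_expansion f 0" and "G = fps_expansion g 0"
  have F: "f has_fps_expansion F" and G: "g has_fps_expansion G"
    unfolding F_def G_def using f g by (simp_all add: analytic_at_imp_has_fps_expansion_0)
  have G0: "fps_nth G 0 = 0"
    using g0 by (simp add: G_def fps_expansion_def)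
  have comp: "(\<lambda>z. f (g z)) has_fps_expansion fps_compose F G"
    using has_fps_expansion_compose[OF F G G0] by (simp add: o_def)
  have pow: "egf_coeff (\<lambda>z. g z ^ j / fact j) n = fact n * fps_nth (G ^ j) n / fact j" for j
  proof -
    have "(\<lambda>z. g z ^ j * (1 / fact j)) has_fps_expansion G ^ j * fps_const (1 / fact j)"
      by (intro fps_expansion_intros G)
    from egf_coeff_has_fps_expansion[OF this] show ?thesis
      by simp
  qed
  show ?thesis
    by (simp add: egf_coeff_has_fps_expansion[OF comp] egf_coeff_has_fps_expansion[OF F] pow
        fps_compose_nth sum_distrib_left mult_ac)
qed

lemma egf_coeff_power_compose:
  assumes h: "h analytic_on {0}" "h 0 = 0" and C: "C analytic_on {0}" "C 0 = 1"
  shows "egf_coeff (\<lambda>z. h (C z - 1) ^ k / fact k) n =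
           (\<Sum>j=k..n. F_stirling2 C n j * egf_coeff (\<lambda>z. h z ^ k / fact k) j)"
proof -
  have "egf_coeff (\<lambda>z. h (C z - 1) ^ k / fact k) n =
          (\<Sum>j=0..n. F_stirling2 C n j * egf_coeff (\<lambda>z. h z ^ k / fact k) j)"
    unfolding F_stirling2_def using h C
    by (intro egf_coeff_compose[where f = "\<lambda>z. h z ^ k / fact k" and g = "\<lambda>z. C z - 1"]
        analytic_intros) auto
  \<comment> \<open>As \<open>h 0 = 0\<close>, the power \<open>h z ^ k\<close> has order at least k
    at 0. For k > n this makes every term vanish.\<close>
  also have "\<dots> = (\<Sum>j=k..n. F_stirling2 C n j * egf_coeff (\<lambda>z. h z ^ k / fact k) j)"
    using egf_coeff_power_eq_0[OF h] by (intro sum.mono_neutral_right) auto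
  finally show ?thesis .
qed

theorem theorem6:
  fixes B C :: "complex \<Rightarrow> complex"
  assumes "B analytic_on {0}" and "C analytic_on {0}"
    and "B 0 = 1" and "C 0 = 1"
  shows "(\<forall>n k. k \<le> n \<longrightarrow>
            F_stirling1 (shifted_comp B C) n k
              = (\<Sum>j=k..n. F_stirling2 C n j * F_stirling1 B j k) \<and>
            F_stirling2 (shifted_comp B C) n k
              = (\<Sum>j=k..n. F_stirling2 C n j * F_stirling2 B j k)) \<and>
         (\<forall>n k. k \<le> n \<longrightarrow>
            F_stirling1 C n k = (\<Sum>j=k..n. F_stirling2 C n j * signed_stirling1 j k))"
proof -
  have s_comp: "F_stirling1 (shifted_comp B C) n k
      = (\<Sum>j=k..n. F_stirling2 C n j * F_stirling1 B j k)" for n k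
    unfolding F_stirling1_def shifted_comp_def
    using assms Ln_analytic_at_0
    by (intro egf_coeff_power_compose[where h = "\<lambda>z. Ln (B z)"]) auto
  have S_comp: "F_stirling2 (shifted_comp B C) n k
      = (\<Sum>j=k..n. F_stirling2 C n j * F_stirling2 B j k)" for n k
    \<comment> \<open>The factor \<open>F_stirling2 C n j\<close> must stay folded to match the
      lemma.\<close>
    unfolding F_stirling2_def[of "shifted_comp B C"] F_stirling2_def[of B] shifted_comp_def
    using assms
    by (intro egf_coeff_power_compose[where h = "\<lambda>z. B z - 1"] analytic_intros) auto
  \<comment> \<open>This is the case B(z) = 1 + z, where the shifted composition is \<open>C\<close>
    itself.\<close>
  have "(\<lambda>z. Ln (1 + z)) analytic_on {0}"
    by (intro analytic_intros) auto
  then have "F_stirling1 C n k = (\<Sum>j=k..n. F_stirling2 C n j * signed_stirling1 j k)" for n k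
    using assms egf_coeff_power_compose[where h = "\<lambda>z. Ln (1 + z)"]
    by (simp add: F_stirling1_def signed_stirling1_def)
  with s_comp S_comp show ?thesis
    by blast
qed

end
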